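(* Let $\mathcal{C}$ be a regular category with a fixed class $\mathcal{Z}$ of zero objects, with coreflector $\mathsf{Z}$. Let $\mathcal{F}$ be a full, replete, reflective subcategory of $\mathcal{C}$, with inclusion $\mathsf{i}\colon\mathcal{F}\hookrightarrow\mathcal{C}$, reflector $\mathsf{F}\colon\mathcal{C}\to\mathcal{F}$ and unit $\eta$ of $\mathsf{F}\dashv\mathsf{i}$, such that: - every component $\eta_A\colon A\to\mathsf{F}(A)$ is a $\mathcal{Z}$-cokernel; - $\mathsf{F}(Z)=Z$ for every $Z\in\mathcal{Z}$ (i.e. $\eta_Z$ is an isomorphism); - for every object $B$ of $\mathcal{C}$ and every arrow $f\colon A\to\mathsf{F}(B)$ of $\mathcal{F}$ inverted by $\mathsf{Z}$, $\mathsf{F}(f^*(\eta_B))$ is an isomorphism, where $f^*(\eta_B)$ is the pullback of $\eta_B$ along $f$. Then $\mathcal{F}$ is the torsion-free part of a $\mathcal{Z}$-torsion theory $(\mathcal{T},\mathcal{F})$ in $\mathcal{C}$ (so $\mathcal{T}\cap\mathcal{F}=\mathcal{Z}$) satisfying Condition (M').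
   Context: A class of zero objects in a category $\mathcal{C}$ is a full subcategory $\mathcal{Z}$ (taken closed under isomorphism) which is posetal (at most one morphism between any two of its objects), monocoreflective (the inclusion has a right adjoint $\mathsf{Z}$, the coreflector, with every counit component $\varepsilon_A\colon\mathsf{Z}(A)\to A$ a monomorphism), and such that $\mathsf{Z}(m)$ is an isomorphism for every monomorphism $m$ of $\mathcal{C}$. An arrow $f$ is inverted by $\mathsf{Z}$ if $\mathsf{Z}(f)$ is an isomorphism. $\mathcal{N}_{\mathcal{Z}}$ denotes the class of arrows of $\mathcal{C}$ factoring through an object of $\mathcal{Z}$. A $\mathcal{Z}$-kernel of $f\colon A\to B$ is an arrow $k\colon K\to A$ with $fk\in\mathcal{N}_{\mathcal{Z}}$ such that every $e\colon E\to A$ with $fe\in\mathcal{N}_{\mathcal{Z}}$ factors uniquely through $k$; $\mathcal{Z}$-cokernels are defined dually; an arrow "is a $\mathcal{Z}$-cokernel" if it is one of some arrow. A sequence $A\xrightarrow{f}B\xrightarrow{g}C$ is short $\mathcal{Z}$-exact if $f$ is a $\mathcal{Z}$-kernel of $g$ and $g$ is a $\mathcal{Z}$-cokernel of $f$. A $\mathcal{Z}$-torsion theory is a pair $(\mathcal{T},\mathcal{F})$ of full replete subcategories of $\mathcal{C}$ such that: $\mathcal{T}\cap\mathcal{F}=\mathcal{Z}$; every arrow $T\to F$ with $T\in\mathcal{T}$, $F\in\mathcal{F}$ lies in $\mathcal{N}_{\mathcal{Z}}$; for every $A\in\mathcal{C}$ there is a short $\mathcal{Z}$-exact sequence $\mathsf{T}(A)\xrightarrow{t_A}A\xrightarrow{\eta_A}\mathsf{F}(A)$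 with $\mathsf{T}(A)\in\mathcal{T}$, $\mathsf{F}(A)\in\mathcal{F}$ (unique up to isomorphism). Then $\mathsf{F}$ is (the object part of) the reflector onto $\mathcal{F}$, with unit $\eta$. $\mathcal{F}$ is called the torsion-free part. Condition (M'): for every object $A$ of $\mathcal{C}$, $\mathsf{F}(\mathsf{T}(A))\cong\mathsf{Z}(\mathsf{F}(A))$. *)

theory Defs
  imports Main
begin

section \<open>Categories\<close>

record ('o, 'm) cat =
  Obj :: "'o set"
  Arr :: "'m set"
  Dom :: "'m \<Rightarrow> 'o"
  Cod :: "'m \<Rightarrow> 'o"
  Ide :: "'o \<Rightarrow> 'm"
  Comp :: "'m \<Rightarrow> 'm \<Rightarrow> 'm"  (infixr "\<cdot>\<index>" 70)

definition hom :: "('o, 'm) cat \<Rightarrow> 'o \<Rightarrow> 'o \<Rightarrow> 'm set" where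
  "hom C A B = {f \<in> Arr C. Dom C f = A \<and> Cod C f = B}"

locale category =
  fixes C :: "('o, 'm) cat" (structure)
  assumes dom_closed: "f \<in> Arr C \<Longrightarrow> Dom C f \<in> Obj C"
    and cod_closed: "f \<in> Arr C \<Longrightarrow> Cod C f \<in> Obj C"
    and ide_hom: "A \<in> Obj C \<Longrightarrow> Ide C A \<in> hom C A A"
    and comp_hom: "\<lbrakk>f \<in> hom C A B; g \<in> hom C B D\<rbrakk> \<Longrightarrow> g \<cdot> f \<in> hom C A D"
    and comp_assoc: "\<lbrakk>f \<in> hom C A B; g \<in> hom C B D; h \<in> hom C D E\<rbrakk>
          \<Longrightarrow> (h \<cdot> g) \<cdot> f = h \<cdot> (g \<cdot> f)"
    and comp_ide_right: "f \<in> hom C A B \<Longrightarrow> f \<cdot> Ide C A = f"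
    and comp_ide_left: "f \<in> hom C A B \<Longrightarrow> Ide C B \<cdot> f = f"

definition iso_arr :: "('o, 'm) cat \<Rightarrow> 'm \<Rightarrow> bool" where
  "iso_arr C f \<longleftrightarrow> f \<in> Arr C \<and>
     (\<exists>g \<in> hom C (Cod C f) (Dom C f).
        g \<cdot>\<^bsub>C\<^esub> f = Ide C (Dom C f) \<and> f \<cdot>\<^bsub>C\<^esub> g = Ide C (Cod C f))"

definition iso_obj :: "('o, 'm) cat \<Rightarrow> 'o \<Rightarrow> 'o \<Rightarrow> bool" where
  "iso_obj C A B \<longleftrightarrow> (\<exists>f \<in> hom C A B. iso_arr C f)"

definition mono_arr :: "('o, 'm) cat \<Rightarrow> 'm \<Rightarrow> bool" where
  "mono_arr C m \<longleftrightarrow> m \<in> Arr C \<and>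
     (\<forall>A. \<forall>g \<in> hom C A (Dom C m). \<forall>h \<in> hom C A (Dom C m).
        m \<cdot>\<^bsub>C\<^esub> g = m \<cdot>\<^bsub>C\<^esub> h \<longrightarrow> g = h)"


section \<open>Regular categories\<close>

definition terminal :: "('o, 'm) cat \<Rightarrow> 'o \<Rightarrow> bool" where
  "terminal C T \<longleftrightarrow> T \<in> Obj C \<and> (\<forall>A \<in> Obj C. \<exists>!f. f \<in> hom C A T)"

text \<open>
  In \<open>pullback C f g p q\<close> the arrow \<open>p\<close> is the pullback of \<open>g\<close> along \<open>f\<close>
  (it has codomain the domain of \<open>f\<close>), and \<open>q\<close> is the pullback of \<open>f\<close> along \<open>g\<close>.
\<close>

definition pullback :: "('o, 'm) cat \<Rightarrow> 'm \<Rightarrow> 'm \<Rightarrow> 'm \<Rightarrow> 'm \<Rightarrow> bool" where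
  "pullback C f g p q \<longleftrightarrow>
     f \<in> Arr C \<and> g \<in> Arr C \<and> Cod C f = Cod C g \<and>
     p \<in> hom C (Dom C p) (Dom C f) \<and> q \<in> hom C (Dom C p) (Dom C g) \<and>
     f \<cdot>\<^bsub>C\<^esub> p = g \<cdot>\<^bsub>C\<^esub> q \<and>
     (\<forall>X. \<forall>a \<in> hom C X (Dom C f). \<forall>b \<in> hom C X (Dom C g).
        f \<cdot>\<^bsub>C\<^esub> a = g \<cdot>\<^bsub>C\<^esub> b \<longrightarrow>
        (\<exists>!u. u \<in> hom C X (Dom C p) \<and> p \<cdot>\<^bsub>C\<^esub> u = a \<and> q \<cdot>\<^bsub>C\<^esub> u = b))"

definition coequalizer :: "('o, 'm) cat \<Rightarrow> 'm \<Rightarrow> 'm \<Rightarrow> 'm \<Rightarrow> bool" where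
  "coequalizer C p q e \<longleftrightarrow>
     p \<in> Arr C \<and> q \<in> hom C (Dom C p) (Cod C p) \<and> e \<in> hom C (Cod C p) (Cod C e) \<and>
     e \<cdot>\<^bsub>C\<^esub> p = e \<cdot>\<^bsub>C\<^esub> q \<and>
     (\<forall>X. \<forall>a \<in> hom C (Cod C p) X. a \<cdot>\<^bsub>C\<^esub> p = a \<cdot>\<^bsub>C\<^esub> q \<longrightarrow>
        (\<exists>!u. u \<in> hom C (Cod C e) X \<and> u \<cdot>\<^bsub>C\<^esub> e = a))"

definition regular_epi :: "('o, 'm) cat \<Rightarrow> 'm \<Rightarrow> bool" where
  "regular_epi C e \<longleftrightarrow> (\<exists>p q. coequalizer C p q e)"

definition kernel_pair :: "('o, 'm) cat \<Rightarrow> 'm \<Rightarrow> 'm \<Rightarrow> 'm \<Rightarrow> bool" where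
  "kernel_pair C f p q \<longleftrightarrow> pullback C f f p q"

text \<open>Finite completeness is rendered as existence of a terminal object and of all pullbacks.\<close>

locale regular_category = category C for C :: "('o, 'm) cat" (structure) +
  assumes has_terminal: "\<exists>T. terminal C T"
    and has_pullbacks:
      "\<lbrakk>f \<in> Arr C; g \<in> Arr C; Cod C f = Cod C g\<rbrakk> \<Longrightarrow> \<exists>p q. pullback C f g p q"
    and kernel_pairs_have_coequalizers:
      "kernel_pair C f p q \<Longrightarrow> \<exists>e. coequalizer C p q e"
    and regular_epi_pullback_stable:
      "\<lbrakk>pullback C f g p q; regular_epi C g\<rbrakk> \<Longrightarrow> regular_epi C p"


section \<open>Functors and adjunctions\<close>

record ('o, 'm, 'p, 'n) cfunctor =
  FObj :: "'o \<Rightarrow> 'p"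
  FArr :: "'m \<Rightarrow> 'n"

definition is_functor ::
  "('o, 'm) cat \<Rightarrow> ('p, 'n) cat \<Rightarrow> ('o, 'm, 'p, 'n) cfunctor \<Rightarrow> bool" where
  "is_functor C D F \<longleftrightarrow>
     (\<forall>A \<in> Obj C. FObj F A \<in> Obj D) \<and>
     (\<forall>f \<in> Arr C. FArr F f \<in> hom D (FObj F (Dom C f)) (FObj F (Cod C f))) \<and>
     (\<forall>A \<in> Obj C. FArr F (Ide C A) = Ide D (FObj F A)) \<and>
     (\<forall>f \<in> Arr C. \<forall>g \<in> Arr C. Cod C f = Dom C g \<longrightarrow>
        FArr F (g \<cdot>\<^bsub>C\<^esub> f) = FArr F g \<cdot>\<^bsub>D\<^esub> FArr F f)"

definition functor_comp ::
  "('p, 'n, 'r, 'k) cfunctor \<Rightarrow> ('o, 'm, 'p, 'n) cfunctor \<Rightarrow> ('o, 'm, 'r, 'k) cfunctor" where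
  "functor_comp G F = \<lparr>FObj = FObj G \<circ> FObj F, FArr = FArr G \<circ> FArr F\<rparr>"

text \<open>The same pair of maps serves as identity functor and as inclusion of any subcategory.\<close>

definition incl :: "('o, 'm, 'o, 'm) cfunctor" where
  "incl = \<lparr>FObj = (\<lambda>A. A), FArr = (\<lambda>f. f)\<rparr>"

definition nat_trans ::
  "('o, 'm) cat \<Rightarrow> ('p, 'n) cat \<Rightarrow> ('o, 'm, 'p, 'n) cfunctor \<Rightarrow> ('o, 'm, 'p, 'n) cfunctor
    \<Rightarrow> ('o \<Rightarrow> 'n) \<Rightarrow> bool" where
  "nat_trans C D F G \<tau> \<longleftrightarrow>
     (\<forall>A \<in> Obj C. \<tau> A \<in> hom D (FObj F A) (FObj G A)) \<and>
     (\<forall>f \<in> Arr C. \<tau> (Cod C f) \<cdot>\<^bsub>D\<^esub> FArr F f = FArr G f \<cdot>\<^bsub>D\<^esub> \<tau> (Dom C f))"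

definition adjunction_unit ::
  "('o, 'm) cat \<Rightarrow> ('p, 'n) cat \<Rightarrow> ('o, 'm, 'p, 'n) cfunctor \<Rightarrow> ('p, 'n, 'o, 'm) cfunctor
    \<Rightarrow> ('o \<Rightarrow> 'm) \<Rightarrow> bool" where
  "adjunction_unit C D L R \<eta> \<longleftrightarrow>
     is_functor C D L \<and> is_functor D C R \<and>
     nat_trans C C incl (functor_comp R L) \<eta> \<and>
     (\<forall>A \<in> Obj C. \<forall>X \<in> Obj D. \<forall>f \<in> hom C A (FObj R X).
        \<exists>!g. g \<in> hom D (FObj L A) X \<and> FArr R g \<cdot>\<^bsub>C\<^esub> \<eta> A = f)"

definition adjunction_counit ::
  "('o, 'm) cat \<Rightarrow> ('p, 'n) cat \<Rightarrow> ('o, 'm, 'p, 'n) cfunctor \<Rightarrow> ('p, 'n, 'o, 'm) cfunctor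
    \<Rightarrow> ('p \<Rightarrow> 'n) \<Rightarrow> bool" where
  "adjunction_counit C D L R \<epsilon> \<longleftrightarrow>
     is_functor C D L \<and> is_functor D C R \<and>
     nat_trans D D (functor_comp L R) incl \<epsilon> \<and>
     (\<forall>A \<in> Obj C. \<forall>X \<in> Obj D. \<forall>f \<in> hom D (FObj L A) X.
        \<exists>!g. g \<in> hom C A (FObj R X) \<and> \<epsilon> X \<cdot>\<^bsub>D\<^esub> FArr L g = f)"


section \<open>Full subcategories\<close>

text \<open>A full subcategory is given by its set of objects.\<close>

definition full_subcategory :: "('o, 'm) cat \<Rightarrow> 'o set \<Rightarrow> ('o, 'm) cat" where
  "full_subcategory C S =
     C\<lparr>Obj := S, Arr := {f \<in> Arr C. Dom C f \<in> S \<and> Cod C f \<in> S}\<rparr>"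

definition replete :: "('o, 'm) cat \<Rightarrow> 'o set \<Rightarrow> bool" where
  "replete C S \<longleftrightarrow> S \<subseteq> Obj C \<and> (\<forall>A \<in> S. \<forall>B \<in> Obj C. iso_obj C A B \<longrightarrow> B \<in> S)"

definition reflective ::
  "('o, 'm) cat \<Rightarrow> 'o set \<Rightarrow> ('o, 'm, 'o, 'm) cfunctor \<Rightarrow> ('o \<Rightarrow> 'm) \<Rightarrow> bool" where
  "reflective C S F \<eta> \<longleftrightarrow> adjunction_unit C (full_subcategory C S) F incl \<eta>"

definition coreflective ::
  "('o, 'm) cat \<Rightarrow> 'o set \<Rightarrow> ('o, 'm, 'o, 'm) cfunctor \<Rightarrow> ('o \<Rightarrow> 'm) \<Rightarrow> bool" where
  "coreflective C S Z \<epsilon> \<longleftrightarrow> adjunction_counit (full_subcategory C S) C incl Z \<epsilon>"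


section \<open>Zero objects, kernels and cokernels\<close>

definition zero_objects ::
  "('o, 'm) cat \<Rightarrow> 'o set \<Rightarrow> ('o, 'm, 'o, 'm) cfunctor \<Rightarrow> ('o \<Rightarrow> 'm) \<Rightarrow> bool" where
  "zero_objects C \<Z> Z \<epsilon> \<longleftrightarrow>
     replete C \<Z> \<and>
     (\<forall>A \<in> \<Z>. \<forall>B \<in> \<Z>. \<forall>f \<in> hom C A B. \<forall>g \<in> hom C A B. f = g) \<and>
     coreflective C \<Z> Z \<epsilon> \<and>
     (\<forall>A \<in> Obj C. mono_arr C (\<epsilon> A)) \<and>
     (\<forall>m. mono_arr C m \<longrightarrow> iso_arr C (FArr Z m))"

definition null_arrows :: "('o, 'm) cat \<Rightarrow> 'o set \<Rightarrow> 'm set" where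
  "null_arrows C \<Z> =
     {g \<cdot>\<^bsub>C\<^esub> f | f g. f \<in> Arr C \<and> g \<in> Arr C \<and> Cod C f = Dom C g \<and> Cod C f \<in> \<Z>}"

definition is_Zkernel :: "('o, 'm) cat \<Rightarrow> 'o set \<Rightarrow> 'm \<Rightarrow> 'm \<Rightarrow> bool" where
  "is_Zkernel C \<Z> f k \<longleftrightarrow>
     f \<in> Arr C \<and> k \<in> Arr C \<and> Cod C k = Dom C f \<and> f \<cdot>\<^bsub>C\<^esub> k \<in> null_arrows C \<Z> \<and>
     (\<forall>E. \<forall>e \<in> hom C E (Dom C f). f \<cdot>\<^bsub>C\<^esub> e \<in> null_arrows C \<Z> \<longrightarrow>
        (\<exists>!u. u \<in> hom C E (Dom C k) \<and> k \<cdot>\<^bsub>C\<^esub> u = e))"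

definition is_Zcokernel :: "('o, 'm) cat \<Rightarrow> 'o set \<Rightarrow> 'm \<Rightarrow> 'm \<Rightarrow> bool" where
  "is_Zcokernel C \<Z> f c \<longleftrightarrow>
     f \<in> Arr C \<and> c \<in> Arr C \<and> Dom C c = Cod C f \<and> c \<cdot>\<^bsub>C\<^esub> f \<in> null_arrows C \<Z> \<and>
     (\<forall>E. \<forall>e \<in> hom C (Cod C f) E. e \<cdot>\<^bsub>C\<^esub> f \<in> null_arrows C \<Z> \<longrightarrow>
        (\<exists>!u. u \<in> hom C (Cod C c) E \<and> u \<cdot>\<^bsub>C\<^esub> c = e))"

definition short_Zexact :: "('o, 'm) cat \<Rightarrow> 'o set \<Rightarrow> 'm \<Rightarrow> 'm \<Rightarrow> bool" where
  "short_Zexact C \<Z> f g \<longleftrightarrow> is_Zkernel C \<Z> g f \<and> is_Zcokernel C \<Z> f g"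


section \<open>Torsion theories\<close>

definition torsion_sequence ::
  "('o, 'm) cat \<Rightarrow> 'o set \<Rightarrow> 'o set \<Rightarrow> 'o set \<Rightarrow> 'o \<Rightarrow> 'm \<Rightarrow> 'm \<Rightarrow> bool" where
  "torsion_sequence C \<Z> \<T> \<F> A t e \<longleftrightarrow>
     short_Zexact C \<Z> t e \<and> Cod C t = A \<and> Dom C t \<in> \<T> \<and> Cod C e \<in> \<F>"

definition torsion_theory ::
  "('o, 'm) cat \<Rightarrow> 'o set \<Rightarrow> 'o set \<Rightarrow> 'o set \<Rightarrow> bool" where
  "torsion_theory C \<Z> \<T> \<F> \<longleftrightarrow>
     replete C \<T> \<and> replete C \<F> \<and> \<T> \<inter> \<F> = \<Z> \<and>
     (\<forall>T \<in> \<T>. \<forall>X \<in> \<F>. hom C T X \<subseteq> null_arrows C \<Z>) \<and>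
     (\<forall>A \<in> Obj C. \<exists>t e. torsion_sequence C \<Z> \<T> \<F> A t e)"

text \<open>
  Condition (M'): \<open>F(T(A)) \<cong> Z(F(A))\<close> for every object \<open>A\<close>. Here \<open>F\<close> is the reflector onto the
  torsion-free part. The object \<open>T(A)\<close> is determined only up to isomorphism, so the condition
  is required for the torsion part of every torsion sequence of \<open>A\<close>.
\<close>

definition condition_M' ::
  "('o, 'm) cat \<Rightarrow> 'o set \<Rightarrow> ('o, 'm, 'o, 'm) cfunctor \<Rightarrow> 'o set \<Rightarrow> 'o set
    \<Rightarrow> ('o, 'm, 'o, 'm) cfunctor \<Rightarrow> bool" where
  "condition_M' C \<Z> Z \<T> \<F> F \<longleftrightarrow>
     (\<forall>A \<in> Obj C. \<forall>t e. torsion_sequence C \<Z> \<T> \<F> A t e \<longrightarrow>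
        iso_obj C (FObj F (Dom C t)) (FObj Z (FObj F A)))"

end

theory Submission
  imports Defs
begin

text \<open>
  Since \<open>\<Z> \<subseteq> \<F>\<close>, the counit \<open>\<epsilon>\<close> at \<open>F(A)\<close> is an arrow of \<open>\<F>\<close>; being monic, it is inverted by
  \<open>Z\<close>. The pullback \<open>t\<close> of \<open>\<eta>\<^sub>A\<close> along it is a \<open>\<Z>\<close>-kernel of \<open>\<eta>\<^sub>A\<close>, because null arrows into
  \<open>F(A)\<close> are exactly those factoring through this counit, and the third hypothesis on \<open>\<F>\<close> says
  that \<open>F\<close> sends its domain to \<open>F(Z(F(A))) \<cong> Z(F(A))\<close>. Hence one takes for \<open>\<T>\<close> the objects sent
  by \<open>F\<close> into \<open>\<Z>\<close>. A \<open>\<Z>\<close>-cokernel is always a \<open>\<Z>\<close>-cokernel of its \<open>\<Z>\<close>-kernel.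
\<close>

section \<open>Typed arrows, full subcategories, and direct consequences of the universal
  properties\<close>

lemma in_homD:
  assumes "f \<in> hom C A B"
  shows "f \<in> Arr C" "Dom C f = A" "Cod C f = B"
  using assms by (simp_all add: hom_def)

lemma full_subcategory_sel [simp]:
  "Obj (full_subcategory C S) = S"
  "Arr (full_subcategory C S) = {f \<in> Arr C. Dom C f \<in> S \<and> Cod C f \<in> S}"
  "Dom (full_subcategory C S) = Dom C"
  "Cod (full_subcategory C S) = Cod C"
  "Ide (full_subcategory C S) = Ide C"
  "Comp (full_subcategory C S) = Comp C"
  by (simp_all add: full_subcategory_def)

lemma hom_full_subcategory:
  "f \<in> hom (full_subcategory C S) A B \<longleftrightarrow> f \<in> hom C A B \<and> A \<in> S \<and> B \<in> S"
  by (auto simp: hom_def)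

lemma hom_full_subcategory_eq:
  "A \<in> S \<Longrightarrow> B \<in> S \<Longrightarrow> hom (full_subcategory C S) A B = hom C A B"
  by (auto simp: hom_full_subcategory)

lemma null_arrowsI:
  assumes "f \<in> hom C A W" "g \<in> hom C W B" "W \<in> \<Z>"
  shows "g \<cdot>\<^bsub>C\<^esub> f \<in> null_arrows C \<Z>"
  unfolding null_arrows_def mem_Collect_eq
  using in_homD[OF assms(1)] in_homD[OF assms(2)] assms(3) by metis

lemma Zkernel_factor:
  assumes "is_Zkernel C \<Z> f k" "e \<in> hom C E (Dom C f)" "f \<cdot>\<^bsub>C\<^esub> e \<in> null_arrows C \<Z>"
  shows "\<exists>u \<in> hom C E (Dom C k). k \<cdot>\<^bsub>C\<^esub> u = e"
  using assms unfolding is_Zkernel_def by blast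

text \<open>Both arrows factor the same composite through \<open>k\<close>, so the uniqueness clause
  of the kernel property identifies them; the last two premises are what that clause asks of the
  composite.\<close>

lemma Zkernel_cancel:
  assumes "is_Zkernel C \<Z> f k" "u \<in> hom C E (Dom C k)" "v \<in> hom C E (Dom C k)"
    and "k \<cdot>\<^bsub>C\<^esub> u = k \<cdot>\<^bsub>C\<^esub> v" "k \<cdot>\<^bsub>C\<^esub> u \<in> hom C E (Dom C f)"
    and "f \<cdot>\<^bsub>C\<^esub> (k \<cdot>\<^bsub>C\<^esub> u) \<in> null_arrows C \<Z>"
  shows "u = v"
  using assms unfolding is_Zkernel_def by metis

lemma Zcokernel_factor:
  assumes "is_Zcokernel C \<Z> f c" "e \<in> hom C (Cod C f) E" "e \<cdot>\<^bsub>C\<^esub> f \<in> null_arrows C \<Z>"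
  shows "\<exists>u \<in> hom C (Cod C c) E. u \<cdot>\<^bsub>C\<^esub> c = e"
  using assms unfolding is_Zcokernel_def by blast

context category
begin

section \<open>Isomorphic objects\<close>

lemma hom_objs:
  assumes "f \<in> hom C A B"
  shows "A \<in> Obj C" "B \<in> Obj C"
  using in_homD[OF assms] dom_closed cod_closed by auto

lemma iso_arrE:
  assumes "iso_arr C f" "f \<in> hom C A B"
  obtains g where "g \<in> hom C B A" "g \<cdot> f = Ide C A" "f \<cdot> g = Ide C B"
  using assms by (auto simp: iso_arr_def hom_def)

lemma iso_objI:
  assumes "f \<in> hom C A B" "g \<in> hom C B A" "g \<cdot> f = Ide C A" "f \<cdot> g = Ide C B"
  shows "iso_obj C A B"
proof -
  have "iso_arr C f"
    unfolding iso_arr_def using assms(2-4) in_homD[OF assms(1)] by auto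
  then show ?thesis
    unfolding iso_obj_def using assms(1) by blast
qed

lemma iso_objE:
  assumes "iso_obj C A B"
  obtains f g where "f \<in> hom C A B" "g \<in> hom C B A" "g \<cdot> f = Ide C A" "f \<cdot> g = Ide C B"
proof -
  obtain f where "f \<in> hom C A B" "iso_arr C f"
    using assms unfolding iso_obj_def by blast
  then show thesis
    using that iso_arrE by blast
qed

lemma iso_obj_sym: "iso_obj C A B \<Longrightarrow> iso_obj C B A"
  by (elim iso_objE) (rule iso_objI)

lemma iso_obj_trans:
  assumes "iso_obj C A B" "iso_obj C B D"
  shows "iso_obj C A D"
proof -
  obtain f g where f: "f \<in> hom C A B" "g \<in> hom C B A" "g \<cdot> f = Ide C A" "f \<cdot> g = Ide C B"
    using assms(1) by (rule iso_objE)
  obtain h k where h: "h \<in> hom C B D" "k \<in> hom C D B" "k \<cdot> h = Ide C B" "h \<cdot> k = Ide C D"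
    using assms(2) by (rule iso_objE)
  have hf: "h \<cdot> f \<in> hom C A D" and gk: "g \<cdot> k \<in> hom C D A"
    using f h comp_hom by blast+
  have "(g \<cdot> k) \<cdot> (h \<cdot> f) = Ide C A"
    using comp_assoc[OF hf h(2) f(2)] comp_assoc[OF f(1) h(1,2)] h(3) f(3) comp_ide_left[OF f(1)]
    by simp
  moreover have "(h \<cdot> f) \<cdot> (g \<cdot> k) = Ide C D"
    using comp_assoc[OF gk f(1) h(1)] comp_assoc[OF h(2) f(2,1)] f(4) h(4) comp_ide_left[OF h(2)]
    by simp
  ultimately show ?thesis
    by (rule iso_objI[OF hf gk])
qed

lemma functor_preserves_iso_obj:
  assumes F: "is_functor C (full_subcategory C S) F" and "iso_obj C A B"
  shows "iso_obj C (FObj F A) (FObj F B)"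
proof -
  obtain f g where f: "f \<in> hom C A B" "g \<in> hom C B A" "g \<cdot> f = Ide C A" "f \<cdot> g = Ide C B"
    using assms(2) by (rule iso_objE)
  note fD = in_homD[OF f(1)] and gD = in_homD[OF f(2)]
  have "FArr F f \<in> hom C (FObj F A) (FObj F B)" "FArr F g \<in> hom C (FObj F B) (FObj F A)"
    using F fD gD unfolding is_functor_def hom_full_subcategory by metis+
  moreover have "FArr F g \<cdot> FArr F f = Ide C (FObj F A)" "FArr F f \<cdot> FArr F g = Ide C (FObj F B)"
    using F fD gD f hom_objs[OF f(1)] unfolding is_functor_def full_subcategory_sel by metis+
  ultimately show ?thesis
    by (rule iso_objI)
qed

section \<open>Null arrows, kernels and cokernels relative to \<open>\<Z>\<close>\<close>

lemma null_arrows_precomp: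
  assumes "n \<in> null_arrows C \<Z>" "n \<in> hom C B D" "x \<in> hom C A B"
  shows "n \<cdot> x \<in> null_arrows C \<Z>"
proof -
  obtain f g where fg: "f \<in> Arr C" "g \<in> Arr C" "Cod C f = Dom C g" "Cod C f \<in> \<Z>" "n = g \<cdot> f"
    using assms(1) unfolding null_arrows_def by blast
  have g: "g \<in> hom C (Cod C f) (Cod C g)" and f: "f \<in> hom C (Dom C f) (Cod C f)"
    using fg by (auto simp: hom_def)
  \<comment> \<open>A factorization of a null arrow comes with untyped factors; its outer end is
    read off from the composite.\<close>
  have "Dom C f = B"
    using comp_hom[OF f g] assms(2) fg(5) by (simp add: hom_def)
  then have x: "x \<in> hom C A (Dom C f)"
    using assms(3) by simp
  show ?thesis
    using null_arrowsI[OF comp_hom[OF x f] g fg(4)] comp_assoc[OF x f g] fg(5) by simp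
qed

lemma null_arrows_postcomp:
  assumes "n \<in> null_arrows C \<Z>" "n \<in> hom C A B" "x \<in> hom C B D"
  shows "x \<cdot> n \<in> null_arrows C \<Z>"
proof -
  obtain f g where fg: "f \<in> Arr C" "g \<in> Arr C" "Cod C f = Dom C g" "Cod C f \<in> \<Z>" "n = g \<cdot> f"
    using assms(1) unfolding null_arrows_def by blast
  have g: "g \<in> hom C (Cod C f) (Cod C g)" and f: "f \<in> hom C (Dom C f) (Cod C f)"
    using fg by (auto simp: hom_def)
  have "Cod C g = B"
    using comp_hom[OF f g] assms(2) fg(5) by (simp add: hom_def)
  then have x: "x \<in> hom C (Cod C g) D"
    using assms(3) by simp
  show ?thesis
    using null_arrowsI[OF f comp_hom[OF g x] fg(4)] comp_assoc[OF f g x] fg(5) by simp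
qed

text \<open>The universal property of a kernel refers to an arrow only through the set of
  \<open>x\<close> it sends to null arrows. Equal sets thus give mutually inverse comparison maps,
  even if \<open>f\<close> and \<open>g\<close> have different codomains.\<close>

lemma Zkernels_iso_obj:
  assumes k: "is_Zkernel C \<Z> f k" and l: "is_Zkernel C \<Z> g l" and dom: "Dom C f = Dom C g"
    and null: "\<And>E x. x \<in> hom C E (Dom C f) \<Longrightarrow>
      f \<cdot> x \<in> null_arrows C \<Z> \<longleftrightarrow> g \<cdot> x \<in> null_arrows C \<Z>"
  shows "iso_obj C (Dom C k) (Dom C l)"
proof -
  have kh: "k \<in> hom C (Dom C k) (Dom C f)" and kn: "f \<cdot> k \<in> null_arrows C \<Z>"
    using k by (auto simp: is_Zkernel_def hom_def)
  have lh: "l \<in> hom C (Dom C l) (Dom C g)" and ln: "g \<cdot> l \<in> null_arrows C \<Z>"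
    using l by (auto simp: is_Zkernel_def hom_def)
  obtain u where u: "u \<in> hom C (Dom C k) (Dom C l)" "l \<cdot> u = k"
    using Zkernel_factor[OF l] kh kn null dom by metis
  obtain v where v: "v \<in> hom C (Dom C l) (Dom C k)" "k \<cdot> v = l"
    using Zkernel_factor[OF k] lh ln null dom by metis
  have kk: "k \<cdot> (v \<cdot> u) = k" and ll: "l \<cdot> (u \<cdot> v) = l"
    using comp_assoc[OF u(1) v(1) kh] comp_assoc[OF v(1) u(1) lh] u(2) v(2) by simp_all
  have "v \<cdot> u = Ide C (Dom C k)"
    using Zkernel_cancel[OF k comp_hom[OF u(1) v(1)] ide_hom] kk kh kn
    by (simp add: comp_ide_right hom_objs[OF kh])
  moreover have "u \<cdot> v = Ide C (Dom C l)"
    using Zkernel_cancel[OF l comp_hom[OF v(1) u(1)] ide_hom] ll lh ln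
    by (simp add: comp_ide_right hom_objs[OF lh])
  ultimately show ?thesis
    using iso_objI[OF u(1) v(1)] by blast
qed

text \<open>As \<open>c\<close> kills \<open>f\<close>, the arrow \<open>f\<close> factors as
  \<open>k\<close> after some \<open>u\<close>. Whatever kills \<open>k\<close> therefore kills
  \<open>f\<close>, and the universal property of \<open>c\<close> with respect to \<open>f\<close>
  applies.\<close>

lemma Zcokernel_of_Zkernel:
  assumes "is_Zcokernel C \<Z> f c" "is_Zkernel C \<Z> c k"
  shows "is_Zcokernel C \<Z> k c"
proof -
  have f: "f \<in> hom C (Dom C f) (Dom C c)" "c \<cdot> f \<in> null_arrows C \<Z>"
    and c: "c \<in> Arr C" "Dom C c = Cod C f"
    using assms(1) by (auto simp: is_Zcokernel_def hom_def)
  have k: "k \<in> hom C (Dom C k) (Dom C c)" "c \<cdot> k \<in> null_arrows C \<Z>"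
    using assms(2) by (auto simp: is_Zkernel_def hom_def)
  obtain u where u: "u \<in> hom C (Dom C f) (Dom C k)" "k \<cdot> u = f"
    using Zkernel_factor[OF assms(2) f] by blast
  have "e \<cdot> f \<in> null_arrows C \<Z>"
    if e: "e \<in> hom C (Dom C c) E" "e \<cdot> k \<in> null_arrows C \<Z>" for e E
    using null_arrows_precomp[OF e(2) comp_hom[OF k(1) e(1)] u(1)] comp_assoc[OF u(1) k(1) e(1)] u(2)
    by simp
  then show ?thesis
    using assms(1) k c unfolding is_Zcokernel_def by (auto simp: in_homD)
qed

section \<open>The counit of the coreflection onto \<open>\<Z>\<close>\<close>

lemma zero_objects_counit:
  assumes "zero_objects C \<Z> Z \<epsilon>" "B \<in> Obj C"
  shows "FObj Z B \<in> \<Z>" "\<epsilon> B \<in> hom C (FObj Z B) B" "mono_arr C (\<epsilon> B)" "iso_arr C (FArr Z (\<epsilon> B))"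
  using assms
  by (auto simp: zero_objects_def coreflective_def adjunction_counit_def nat_trans_def
      is_functor_def incl_def functor_comp_def)

text \<open>The second factor of a null arrow starts at an object of \<open>\<Z>\<close>, so
  couniversality of the counit factors it through \<open>\<epsilon> B\<close>.\<close>

lemma null_arrow_factors_counit:
  assumes Z: "zero_objects C \<Z> Z \<epsilon>" and x: "x \<in> null_arrows C \<Z>" "x \<in> hom C E B"
  shows "\<exists>v \<in> hom C E (FObj Z B). \<epsilon> B \<cdot> v = x"
proof -
  obtain f g where fg: "f \<in> Arr C" "g \<in> Arr C" "Cod C f = Dom C g" "Cod C f \<in> \<Z>" "x = g \<cdot> f"
    using x(1) unfolding null_arrows_def by blast
  have g: "g \<in> hom C (Cod C f) (Cod C g)" and f: "f \<in> hom C (Dom C f) (Cod C f)"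
    using fg by (auto simp: hom_def)
  have eq: "Dom C f = E" "Cod C g = B"
    using comp_hom[OF f g] x(2) fg(5) by (simp_all add: hom_def)
  have B: "B \<in> Obj C"
    using hom_objs[OF x(2)] by blast
  have "\<exists>!w. w \<in> hom (full_subcategory C \<Z>) (Cod C f) (FObj Z B) \<and> \<epsilon> B \<cdot> w = g"
    using Z B g eq fg(4)
    by (simp add: zero_objects_def coreflective_def adjunction_counit_def incl_def)
  then obtain w where w: "w \<in> hom C (Cod C f) (FObj Z B)" "\<epsilon> B \<cdot> w = g"
    unfolding hom_full_subcategory by blast
  have "\<epsilon> B \<cdot> (w \<cdot> f) = x"
    using comp_assoc[OF f w(1) zero_objects_counit(2)[OF Z B]] w(2) fg(5) by simp
  then show ?thesis
    using comp_hom[OF f w(1)] eq by blast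
qed

text \<open>If \<open>h\<close> sends \<open>e\<close> to a null arrow, that arrow lifts along
  \<open>\<epsilon> B\<close>, which completes \<open>e\<close> to a cone over the pullback. Since
  the counit is monic, the \<open>p\<close>-component of a map into the pullback is determined by
  its \<open>t\<close>-component, so uniqueness can be tested on \<open>t\<close> alone.\<close>

lemma Zkernel_pullback_counit:
  assumes Z: "zero_objects C \<Z> Z \<epsilon>" and h: "h \<in> hom C A B" and pb: "pullback C (\<epsilon> B) h p t"
  shows "is_Zkernel C \<Z> h t"
proof -
  note eps = zero_objects_counit[OF Z hom_objs(2)[OF h]]
  have p: "p \<in> hom C (Dom C p) (FObj Z B)" and t: "t \<in> hom C (Dom C p) A"
    and comm: "\<epsilon> B \<cdot> p = h \<cdot> t"
    using pb in_homD[OF h] in_homD[OF eps(2)] unfolding pullback_def by auto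
  have univ: "\<exists>!u. u \<in> hom C E (Dom C p) \<and> p \<cdot> u = a \<and> t \<cdot> u = b"
    if "a \<in> hom C E (FObj Z B)" "b \<in> hom C E A" "\<epsilon> B \<cdot> a = h \<cdot> b" for E a b
    using pb that in_homD[OF h] in_homD[OF eps(2)] unfolding pullback_def by metis
  have "\<exists>!u. u \<in> hom C E (Dom C p) \<and> t \<cdot> u = e"
    if e: "e \<in> hom C E A" and n: "h \<cdot> e \<in> null_arrows C \<Z>" for E e
  proof -
    obtain v where v: "v \<in> hom C E (FObj Z B)" "\<epsilon> B \<cdot> v = h \<cdot> e"
      using null_arrow_factors_counit[OF Z n comp_hom[OF e h]] by blast
    have "p \<cdot> u = v" if u: "u \<in> hom C E (Dom C p)" "t \<cdot> u = e" for u
    proof -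
      have "\<epsilon> B \<cdot> (p \<cdot> u) = \<epsilon> B \<cdot> v"
        using comp_assoc[OF u(1) p eps(2)] comp_assoc[OF u(1) t h] comm u(2) v(2) by simp
      then show ?thesis
        using eps(3) comp_hom[OF u(1) p] v(1) in_homD[OF eps(2)] unfolding mono_arr_def by metis
    qed
    then show ?thesis
      using univ[OF v(1) e v(2)] by metis
  qed
  moreover have "h \<cdot> t \<in> null_arrows C \<Z>"
    using null_arrowsI[OF p eps(2) eps(1)] comm by simp
  ultimately show ?thesis
    unfolding is_Zkernel_def using in_homD[OF h] in_homD[OF t] by simp
qed

section \<open>Units of reflections\<close>

lemma reflective_unit:
  assumes "reflective C \<F> F \<eta>" "A \<in> Obj C"
  shows "FObj F A \<in> \<F>" "\<eta> A \<in> hom C A (FObj F A)"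
  using assms
  by (auto simp: reflective_def adjunction_unit_def nat_trans_def
      is_functor_def incl_def functor_comp_def)

lemma reflective_factor:
  assumes "reflective C \<F> F \<eta>" "f \<in> hom C A X" "X \<in> \<F>"
  shows "\<exists>!g. g \<in> hom C (FObj F A) X \<and> g \<cdot> \<eta> A = f"
proof -
  have A: "A \<in> Obj C"
    using hom_objs[OF assms(2)] by blast
  then have "\<exists>!g. g \<in> hom (full_subcategory C \<F>) (FObj F A) X \<and> g \<cdot> \<eta> A = f"
    using assms by (simp add: reflective_def adjunction_unit_def incl_def)
  then show ?thesis
    using reflective_unit(1)[OF assms(1) A] assms(3) by (simp add: hom_full_subcategory_eq)
qed

text \<open>Factoring the identity of \<open>A\<close> through the unit gives a retraction;
  uniqueness of factorizations of \<open>\<eta> A\<close> through itself makes it a two-sided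
  inverse.\<close>

lemma unit_iso_of_mem_reflective:
  assumes R: "reflective C \<F> F \<eta>" and A: "A \<in> \<F>" "A \<in> Obj C"
  shows "iso_obj C A (FObj F A)"
proof -
  note eta = reflective_unit[OF R A(2)]
  obtain g where g: "g \<in> hom C (FObj F A) A" "g \<cdot> \<eta> A = Ide C A"
    using reflective_factor[OF R ide_hom[OF A(2)] A(1)] by blast
  have "(\<eta> A \<cdot> g) \<cdot> \<eta> A = \<eta> A"
    using comp_assoc[OF eta(2) g(1) eta(2)] g(2) comp_ide_right[OF eta(2)] by simp
  moreover have "Ide C (FObj F A) \<cdot> \<eta> A = \<eta> A"
    using comp_ide_left[OF eta(2)] .
  ultimately have "\<eta> A \<cdot> g = Ide C (FObj F A)"
    using reflective_factor[OF R eta(2,1)] comp_hom[OF g(1) eta(2)]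
      ide_hom[OF hom_objs(2)[OF eta(2)]] by blast
  then show ?thesis
    using iso_objI[OF eta(2) g(1) g(2)] by blast
qed

end

section \<open>The torsion theory attached to the reflection\<close>

theorem proposition4p8:
  fixes C :: "('o, 'm) cat"
    and \<Z> \<F> :: "'o set"
    and Z F :: "('o, 'm, 'o, 'm) cfunctor"
    and \<epsilon> \<eta> :: "'o \<Rightarrow> 'm"
  assumes "regular_category C"
    and "zero_objects C \<Z> Z \<epsilon>"
    and "replete C \<F>"
    and "reflective C \<F> F \<eta>"
    and "\<And>A. A \<in> Obj C \<Longrightarrow> \<exists>f. is_Zcokernel C \<Z> f (\<eta> A)"
    and "\<And>W. W \<in> \<Z> \<Longrightarrow> iso_arr C (\<eta> W)"
    and "\<And>A B f p q. \<lbrakk>B \<in> Obj C; A \<in> \<F>; f \<in> hom C A (FObj F B); iso_arr C (FArr Z f);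
           pullback C f (\<eta> B) p q\<rbrakk> \<Longrightarrow> iso_arr C (FArr F p)"
  shows "\<exists>\<T>. torsion_theory C \<Z> \<T> \<F> \<and> condition_M' C \<Z> Z \<T> \<F> F"
proof -
  interpret regular_category C by fact
  note Z = assms(2) and R = assms(4)
  have F: "is_functor C (full_subcategory C \<F>) F"
    using R by (simp add: reflective_def adjunction_unit_def)
  have repZ: "replete C \<Z>" and repF: "replete C \<F>"
    using Z assms(3) by (simp_all add: zero_objects_def)
  have Z_obj: "W \<in> Obj C" if "W \<in> \<Z>" for W
    using repZ that unfolding replete_def by blast
  have F_obj: "X \<in> Obj C" if "X \<in> \<F>" for X
    using repF that unfolding replete_def by blast
  have Z_closed: "B \<in> \<Z>" if "A \<in> \<Z>" "iso_obj C A B" for A B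
    using repZ that by (metis replete_def iso_objE hom_objs(2))
  have FZ_iso: "iso_obj C W (FObj F W)" if "W \<in> \<Z>" for W
    using reflective_unit(2)[OF R Z_obj] assms(6) that unfolding iso_obj_def by blast
  \<comment> \<open>Repleteness of \<open>\<F>\<close> transfers membership from
    \<open>FObj F W\<close> along the invertible unit.\<close>
  have ZF: "W \<in> \<F>" if "W \<in> \<Z>" for W
    using repF iso_obj_sym[OF FZ_iso[OF that]] reflective_unit(1)[OF R Z_obj[OF that]]
      Z_obj[OF that] unfolding replete_def by blast
  define \<T> where "\<T> = {A \<in> Obj C. FObj F A \<in> \<Z>}"
  have repT: "replete C \<T>"
    unfolding replete_def \<T>_def
    using functor_preserves_iso_obj[OF F] Z_closed by blast
  have TF: "\<T> \<inter> \<F> = \<Z>"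
  proof
    \<comment> \<open>An object of \<open>\<F>\<close> is isomorphic to its reflection, which lies
      in \<open>\<Z>\<close> when the object is in \<open>\<T>\<close>.\<close>
    show "\<T> \<inter> \<F> \<subseteq> \<Z>"
      using unit_iso_of_mem_reflective[OF R] iso_obj_sym Z_closed unfolding \<T>_def by blast
    show "\<Z> \<subseteq> \<T> \<inter> \<F>"
      using ZF Z_obj FZ_iso Z_closed unfolding \<T>_def by blast
  qed
  \<comment> \<open>The reflection factors \<open>f\<close> through \<open>FObj F T\<close>, an
    object of \<open>\<Z>\<close>.\<close>
  have T_null: "f \<in> null_arrows C \<Z>" if T: "T \<in> \<T>" and X: "X \<in> \<F>" and f: "f \<in> hom C T X" for T X f
  proof -
    obtain g where g: "g \<in> hom C (FObj F T) X" "g \<cdot>\<^bsub>C\<^esub> \<eta> T = f"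
      using reflective_factor[OF R f X] by blast
    have FT: "T \<in> Obj C" "FObj F T \<in> \<Z>"
      using T by (auto simp: \<T>_def)
    show ?thesis
      using null_arrowsI[OF reflective_unit(2)[OF R FT(1)] g(1) FT(2)] g(2) by simp
  qed
  have unit_seq: "\<exists>t. torsion_sequence C \<Z> \<T> \<F> A t (\<eta> A) \<and>
      iso_obj C (FObj F (Dom C t)) (FObj Z (FObj F A))" if A: "A \<in> Obj C" for A
  proof -
    note eta = reflective_unit[OF R A]
    note eps = zero_objects_counit[OF Z F_obj[OF eta(1)]]
    obtain p t where pb: "pullback C (\<epsilon> (FObj F A)) (\<eta> A) p t"
      using has_pullbacks in_homD[OF eta(2)] in_homD[OF eps(2)] by metis
    have p: "p \<in> hom C (Dom C p) (FObj Z (FObj F A))" and t: "t \<in> hom C (Dom C p) A"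
      using pb in_homD[OF eta(2)] in_homD[OF eps(2)] unfolding pullback_def by auto
    have "iso_arr C (FArr F p)"
      using assms(7)[OF A ZF[OF eps(1)] eps(2,4) pb] .
    moreover have "FArr F p \<in> hom C (FObj F (Dom C p)) (FObj F (FObj Z (FObj F A)))"
      using F in_homD[OF p] unfolding is_functor_def hom_full_subcategory by metis
    ultimately have "iso_obj C (FObj F (Dom C p)) (FObj F (FObj Z (FObj F A)))"
      unfolding iso_obj_def by blast
    \<comment> \<open>The outer \<open>F\<close> on the right is removed because the unit is
      invertible on objects of \<open>\<Z>\<close>.\<close>
    then have iso: "iso_obj C (FObj F (Dom C p)) (FObj Z (FObj F A))"
      using iso_obj_trans iso_obj_sym FZ_iso[OF eps(1)] by blast
    have ker: "is_Zkernel C \<Z> (\<eta> A) t"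
      using Zkernel_pullback_counit[OF Z eta(2) pb] .
    obtain f where "is_Zcokernel C \<Z> f (\<eta> A)"
      using assms(5)[OF A] by blast
    then have "is_Zcokernel C \<Z> t (\<eta> A)"
      using Zcokernel_of_Zkernel ker by blast
    moreover have "Dom C t \<in> \<T>"
      using Z_closed[OF eps(1) iso_obj_sym[OF iso]] in_homD[OF t] hom_objs[OF t]
      unfolding \<T>_def by simp
    ultimately show ?thesis
      using ker iso eta(1) in_homD[OF eta(2)] in_homD[OF t]
      unfolding torsion_sequence_def short_Zexact_def by auto
  qed
  \<comment> \<open>Condition (M') concerns every torsion sequence of \<open>A\<close>, so an
    arbitrary one is compared with the sequence built on the unit.\<close>
  have M': "iso_obj C (FObj F (Dom C s)) (FObj Z (FObj F A))"
    if A: "A \<in> Obj C" and seq: "torsion_sequence C \<Z> \<T> \<F> A s e" for A s e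
  proof -
    note eta = reflective_unit[OF R A]
    obtain t where ker: "is_Zkernel C \<Z> (\<eta> A) t"
      and iso: "iso_obj C (FObj F (Dom C t)) (FObj Z (FObj F A))"
      using unit_seq[OF A] unfolding torsion_sequence_def short_Zexact_def by blast
    have kers: "is_Zkernel C \<Z> e s" and coker: "is_Zcokernel C \<Z> s e"
      and s: "Dom C s \<in> \<T>" "Cod C s = A" "Cod C e \<in> \<F>"
      using seq unfolding torsion_sequence_def short_Zexact_def by auto
    have sh: "s \<in> hom C (Dom C s) A" and eh: "e \<in> hom C A (Cod C e)"
      using coker s(2) by (auto simp: is_Zcokernel_def hom_def)
    obtain g where g: "g \<in> hom C (FObj F A) (Cod C e)" "g \<cdot>\<^bsub>C\<^esub> \<eta> A = e"
      using reflective_factor[OF R eh s(3)] by blast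
    \<comment> \<open>This composite runs from \<open>\<T>\<close> to \<open>\<F>\<close>, hence is
      null; the cokernel \<open>e\<close> of \<open>s\<close> then factors \<open>\<eta> A\<close>,
      conversely to the factorization of \<open>e\<close> through \<open>\<eta> A\<close>.\<close>
    have "\<eta> A \<cdot>\<^bsub>C\<^esub> s \<in> null_arrows C \<Z>"
      using T_null[OF s(1) eta(1) comp_hom[OF sh eta(2)]] .
    then obtain h where h: "h \<in> hom C (Cod C e) (FObj F A)" "h \<cdot>\<^bsub>C\<^esub> e = \<eta> A"
      using Zcokernel_factor[OF coker] eta(2) s(2) by blast
    have "iso_obj C (Dom C s) (Dom C t)"
    proof (rule Zkernels_iso_obj[OF kers ker])
      show "Dom C e = Dom C (\<eta> A)"
        using in_homD[OF eh] in_homD[OF eta(2)] by simp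
      fix E x
      assume "x \<in> hom C E (Dom C e)"
      then have x: "x \<in> hom C E A"
        using in_homD[OF eh] by simp
      \<comment> \<open>Postcomposition with \<open>h\<close> and with \<open>g\<close> carries
        nullness in the two directions, so \<open>e\<close> and \<open>\<eta> A\<close> kill the
        same arrows and have isomorphic kernels.\<close>
      have "h \<cdot>\<^bsub>C\<^esub> (e \<cdot>\<^bsub>C\<^esub> x) = \<eta> A \<cdot>\<^bsub>C\<^esub> x" "g \<cdot>\<^bsub>C\<^esub> (\<eta> A \<cdot>\<^bsub>C\<^esub> x) = e \<cdot>\<^bsub>C\<^esub> x"
        using comp_assoc[OF x eh h(1)] comp_assoc[OF x eta(2) g(1)] h(2) g(2) by simp_all
      then show "e \<cdot>\<^bsub>C\<^esub> x \<in> null_arrows C \<Z> \<longleftrightarrow> \<eta> A \<cdot>\<^bsub>C\<^esub> x \<in> null_arrows C \<Z>"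
        using null_arrows_postcomp[OF _ comp_hom[OF x eh] h(1)]
          null_arrows_postcomp[OF _ comp_hom[OF x eta(2)] g(1)] by metis
    qed
    then show ?thesis
      using iso_obj_trans[OF functor_preserves_iso_obj[OF F] iso] by blast
  qed
  have "torsion_theory C \<Z> \<T> \<F>"
    unfolding torsion_theory_def using repT repF TF T_null unit_seq by blast
  moreover have "condition_M' C \<Z> Z \<T> \<F> F"
    unfolding condition_M'_def using M' by blast
  ultimately show ?thesis
    by blast
qed

end
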